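(* For every single-qubit state $\ket{\psi}$ we have $\chi(\psi^{\otimes m}) = O\left((m+1)2^{m/2}\right)$ as $m\to\infty$.
   Context: An $n$-qubit stabilizer state is a state of the form $C\ket{0^n}$ with $C$ an $n$-qubit Clifford unitary. The stabilizer rank $\chi(\psi)$ of an $n$-qubit state $\ket{\psi}$ is the minimum $k$ such that $\ket{\psi}=\sum_{i=1}^k c_i\ket{\Phi_i}$ with $c_i\in\mathbb{C}$ and $\ket{\Phi_i}$ stabilizer states. $\psi^{\otimes m}$ denotes $\ket{\psi}^{\otimes m}$. *)

theory Defs
  imports Complex_Main "HOL-Library.Landau_Symbols"
begin

text \<open>Conventions. An n-qubit operator is a function nat => nat => complex (matrix entries
indexed by computational basis labels 0 ..< 2^n, zero outside); an n-qubit vector is a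
function nat => complex, zero outside 0 ..< 2^n. The j-th qubit of basis label r is
(r div 2^j) mod 2.\<close>

definition qbit :: "nat \<Rightarrow> nat \<Rightarrow> nat" where
  "qbit r j = (r div 2 ^ j) mod 2"

definition pauli1 :: "nat \<Rightarrow> nat \<Rightarrow> nat \<Rightarrow> complex" where
  "pauli1 k a b =
     (if k = 0 then (if a = b then 1 else 0)
      else if k = 1 then (if a \<noteq> b then 1 else 0)
      else if k = 2 then (if a = 0 \<and> b = 1 then - \<i> else if a = 1 \<and> b = 0 then \<i> else 0)
      else (if a = b then (if a = 0 then 1 else -1) else 0))"

definition pauli_op :: "nat \<Rightarrow> (nat \<Rightarrow> nat) \<Rightarrow> nat \<Rightarrow> nat \<Rightarrow> complex" where
  "pauli_op n ks r c =
     (if r < 2 ^ n \<and> c < 2 ^ n then (\<Prod>j<n. pauli1 (ks j) (qbit r j) (qbit c j)) else 0)"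

definition pauli_group :: "nat \<Rightarrow> (nat \<Rightarrow> nat \<Rightarrow> complex) set" where
  "pauli_group n = {(\<lambda>r c. \<i> ^ p * pauli_op n ks r c) | p ks. \<forall>j<n. ks j < 4}"

definition mmult :: "nat \<Rightarrow> (nat \<Rightarrow> nat \<Rightarrow> complex) \<Rightarrow> (nat \<Rightarrow> nat \<Rightarrow> complex) \<Rightarrow> nat \<Rightarrow> nat \<Rightarrow> complex" where
  "mmult n A B r c = (if r < 2 ^ n \<and> c < 2 ^ n then (\<Sum>k<2 ^ n. A r k * B k c) else 0)"

definition madj :: "(nat \<Rightarrow> nat \<Rightarrow> complex) \<Rightarrow> nat \<Rightarrow> nat \<Rightarrow> complex" where
  "madj A r c = cnj (A c r)"

definition mid :: "nat \<Rightarrow> nat \<Rightarrow> nat \<Rightarrow> complex" where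
  "mid n r c = (if r < 2 ^ n \<and> r = c then 1 else 0)"

definition is_unitary :: "nat \<Rightarrow> (nat \<Rightarrow> nat \<Rightarrow> complex) \<Rightarrow> bool" where
  "is_unitary n U \<longleftrightarrow>
     (\<forall>r c. \<not> (r < 2 ^ n \<and> c < 2 ^ n) \<longrightarrow> U r c = 0) \<and>
     mmult n U (madj U) = mid n \<and> mmult n (madj U) U = mid n"

definition is_clifford :: "nat \<Rightarrow> (nat \<Rightarrow> nat \<Rightarrow> complex) \<Rightarrow> bool" where
  "is_clifford n C \<longleftrightarrow> is_unitary n C \<and>
     (\<forall>P\<in>pauli_group n. mmult n (mmult n C P) (madj C) \<in> pauli_group n)"

text \<open>Stabilizer state C|0^n>: the 0-th column of a Clifford unitary C.\<close>
definition stabilizer_state :: "nat \<Rightarrow> (nat \<Rightarrow> complex) \<Rightarrow> bool" where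
  "stabilizer_state n v \<longleftrightarrow> (\<exists>C. is_clifford n C \<and> v = (\<lambda>r. C r 0))"

definition stab_decomp :: "nat \<Rightarrow> (nat \<Rightarrow> complex) \<Rightarrow> nat \<Rightarrow> bool" where
  "stab_decomp n v k \<longleftrightarrow> (\<exists>(c :: nat \<Rightarrow> complex) \<Phi>. (\<forall>i<k. stabilizer_state n (\<Phi> i)) \<and>
      v = (\<lambda>r. \<Sum>i<k. c i * \<Phi> i r))"

definition stab_rank :: "nat \<Rightarrow> (nat \<Rightarrow> complex) \<Rightarrow> nat" where
  "stab_rank n v = (LEAST k. stab_decomp n v k)"

definition tpow :: "nat \<Rightarrow> (nat \<Rightarrow> complex) \<Rightarrow> nat \<Rightarrow> complex" where
  "tpow m \<psi> r = (if r < 2 ^ m then (\<Prod>j<m. \<psi> (qbit r j)) else 0)"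

end

theory Submission
  imports Defs
begin

text \<open>If \<open>\<psi> e \<noteq> 0\<close>, then up to a scalar the amplitudes of \<open>\<psi>\<^sup>\<otimes>\<^sup>m\<close> are \<open>z ^ S\<close> where \<open>S\<close> counts the
  bits different from \<open>e\<close>. Adding up these bits in pairs with a chain of full adders gives
  \<open>S = 2 (t\<^sub>1 + \<dots> + t\<^sub>k) + p\<close> with \<open>k\<close> about \<open>m / 2\<close>, where every carry \<open>t\<^sub>i\<close> is a quadratic form over the
  field with two elements and the parity \<open>p\<close> is a linear one. Since \<open>(z\<^sup>2) ^ t\<close> is a combination of \<open>1\<close> and
  \<open>(-1) ^ t\<close>, expanding the product of the \<open>k + 1\<close> factors gives \<open>2 ^ (k + 1)\<close> phases of quadratic
  forms, and each of these is a multiple of a stabilizer state.\<close>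

section \<open>Bits of basis labels and sums over all labels\<close>

lemma qbit_less_2: "qbit r j < 2"
  by (simp add: qbit_def)

lemma qbit_cases: "qbit r j = 0 \<or> qbit r j = 1"
  using qbit_less_2[of r j] by linarith

lemma qbit_eq_0: "r < 2 ^ n \<Longrightarrow> n \<le> j \<Longrightarrow> qbit r j = 0"
  by (metis div_less less_le_trans mod_0 one_le_numeral power_increasing qbit_def)

lemma qbit_add_power_less:
  assumes "j < n"
  shows "qbit (2 ^ n + k) j = qbit k j"
proof -
  \<comment> \<open>For \<open>j < n\<close> the number \<open>2 ^ n\<close> is an even multiple of
    \<open>2 ^ j\<close>, so adding it changes the quotient by \<open>2 ^ j\<close> by an even
    amount.\<close>
  obtain d where "n = j + Suc d"
    using assms less_imp_Suc_add by auto
  then have "2 ^ n + k = k + 2 ^ d * 2 * 2 ^ j"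
    by (simp add: power_add)
  then have "(2 ^ n + k) div 2 ^ j = 2 ^ d * 2 + k div 2 ^ j"
    by (simp only: div_mult_self1 power_not_zero numeral_neq_zero) simp
  then show ?thesis
    by (simp add: qbit_def)
qed

lemma qbit_add_power_same: "k < 2 ^ n \<Longrightarrow> qbit (2 ^ n + k) n = 1"
  by (simp add: qbit_def div_add_self1)

lemma qbit_ext:
  assumes "r < 2 ^ n" "c < 2 ^ n" "\<And>j. j < n \<Longrightarrow> qbit r j = qbit c j"
  shows "r = c"
proof (rule bit_eqI)
  fix j
  have "qbit r j = qbit c j"
    using assms qbit_eq_0[of r n j] qbit_eq_0[of c n j] by (cases "j < n") auto
  then show "bit r j \<longleftrightarrow> bit c j"
    by (simp add: qbit_def bit_iff_odd odd_iff_mod_2_eq_one)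
qed

lemma sum_lessThan_add:
  fixes f :: "nat \<Rightarrow> 'a::comm_monoid_add"
  shows "(\<Sum>k<a + b. f k) = (\<Sum>k<a. f k) + (\<Sum>k<b. f (a + k))"
  by (induction b) (simp_all add: add.assoc)

text \<open>Distributivity over all bit strings. In the induction the labels below
  \<open>2 ^ Suc n\<close> split by their top bit into \<open>k\<close> and
  \<open>2 ^ n + k\<close>, which share the lower bits.\<close>

lemma sum_prod_qbit:
  fixes g :: "nat \<Rightarrow> nat \<Rightarrow> 'a::comm_semiring_1"
  shows "(\<Sum>k<2 ^ n. \<Prod>j<n. g j (qbit k j)) = (\<Prod>j<n. g j 0 + g j 1)"
proof (induction n)
  case 0
  then show ?case by simp
next
  case (Suc n)
  let ?F = "\<lambda>k. \<Prod>j<Suc n. g j (qbit k j)"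
  have low: "(\<Sum>k<2 ^ n. ?F k) = (\<Prod>j<n. g j 0 + g j 1) * g n 0"
    unfolding Suc[symmetric] sum_distrib_right
    by (intro sum.cong refl) (simp add: qbit_eq_0)
  have "(\<Sum>k<2 ^ n. ?F (2 ^ n + k)) = (\<Prod>j<n. g j 0 + g j 1) * g n 1"
    unfolding Suc[symmetric] sum_distrib_right
    by (intro sum.cong refl) (simp add: qbit_add_power_less qbit_add_power_same)
  moreover have "(\<Sum>k<2 ^ Suc n. ?F k) = (\<Sum>k<2 ^ n. ?F k) + (\<Sum>k<2 ^ n. ?F (2 ^ n + k))"
    using sum_lessThan_add[of ?F "2 ^ n" "2 ^ n"] by (simp only: power_Suc mult_2)
  ultimately show ?case
    using low by (simp add: distrib_left)
qed

lemma sum_sum_prod_qbit: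
  fixes g :: "nat \<Rightarrow> nat \<Rightarrow> nat \<Rightarrow> 'a::comm_semiring_1"
  shows "(\<Sum>k<2 ^ n. \<Sum>l<2 ^ n. \<Prod>j<n. g j (qbit k j) (qbit l j))
       = (\<Prod>j<n. g j 0 0 + g j 0 1 + g j 1 0 + g j 1 1)"
proof -
  have "(\<Sum>k<2 ^ n. \<Sum>l<2 ^ n. \<Prod>j<n. g j (qbit k j) (qbit l j))
      = (\<Sum>k<2 ^ n. \<Prod>j<n. g j (qbit k j) 0 + g j (qbit k j) 1)"
    by (simp add: sum_prod_qbit[where g = "\<lambda>j. g j (qbit k j)" for k])
  also have "\<dots> = (\<Prod>j<n. (g j 0 0 + g j 0 1) + (g j 1 0 + g j 1 1))"
    by (rule sum_prod_qbit[where g = "\<lambda>j a. g j a 0 + g j a 1"])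
  finally show ?thesis
    by (simp add: add.assoc)
qed

section \<open>Affine and quadratic forms modulo 2\<close>

text \<open>Forms over the field with two elements are represented by natural-valued functions of
  which only the parity on labels below \<open>2 ^ n\<close> counts. Congruence modulo 2 is
  expressed as evenness of a sum, since signs are irrelevant.\<close>

definition affine_form :: "nat \<Rightarrow> (nat \<Rightarrow> nat) \<Rightarrow> bool" where
  "affine_form n f \<longleftrightarrow> (\<exists>a l. \<forall>r<2 ^ n. even (f r + a + (\<Sum>j<n. l j * qbit r j)))"

text \<open>This is \<open>r = c + s\<close> in the vector space of bit strings; it describes the
  support of a Pauli operator that flips exactly the qubits \<open>j\<close> with \<open>s j\<close>
  odd.\<close>

definition shifted :: "nat \<Rightarrow> (nat \<Rightarrow> nat) \<Rightarrow> nat \<Rightarrow> nat \<Rightarrow> bool" where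
  "shifted n s r c \<longleftrightarrow> r < 2 ^ n \<and> c < 2 ^ n \<and> (\<forall>j<n. even (qbit r j + qbit c j + s j))"

text \<open>Degree at most 2 is encoded without coefficients: every derivative
  \<open>q (c + s) + q c\<close> is affine in \<open>c\<close>. Exactly this property makes
  conjugation by the diagonal phase \<open>(-1) ^ q r\<close> preserve the Pauli group.\<close>

definition quadratic_form :: "nat \<Rightarrow> (nat \<Rightarrow> nat) \<Rightarrow> bool" where
  "quadratic_form n q \<longleftrightarrow>
     (\<forall>s. \<exists>g. affine_form n g \<and> (\<forall>r c. shifted n s r c \<longrightarrow> even (q r + q c + g c)))"

lemma affine_form_const: "affine_form n (\<lambda>_. a)"
  unfolding affine_form_def by (rule exI[of _ a], rule exI[of _ "\<lambda>_. 0"]) simp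

lemma affine_form_qbit: "affine_form n (\<lambda>r. qbit r i)"
proof (cases "i < n")
  case True
  have "(\<Sum>j<n. (if j = i then 1 else 0) * qbit r j) = qbit r i" for r
  proof -
    have "(\<Sum>j<n. (if j = i then 1 else 0) * qbit r j) = (\<Sum>j<n. if j = i then qbit r j else 0)"
      by (intro sum.cong) auto
    then show ?thesis using True by simp
  qed
  then show ?thesis
    unfolding affine_form_def
    by (intro exI[of _ 0] exI[of _ "\<lambda>j. if j = i then 1 else 0"]) simp
next
  case False
  then show ?thesis
    unfolding affine_form_def
    by (intro exI[of _ 0] exI[of _ "\<lambda>j. 0"]) (simp add: qbit_eq_0)
qed

lemma affine_form_add:
  assumes "affine_form n f" "affine_form n g"
  shows "affine_form n (\<lambda>r. f r + g r)"
proof -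
  obtain a l where f: "\<forall>r<2 ^ n. even (f r + a + (\<Sum>j<n. l j * qbit r j))"
    using assms(1) unfolding affine_form_def by blast
  obtain b k where g: "\<forall>r<2 ^ n. even (g r + b + (\<Sum>j<n. k j * qbit r j))"
    using assms(2) unfolding affine_form_def by blast
  show ?thesis
    unfolding affine_form_def
    using f g by (intro exI[of _ "a + b"] exI[of _ "\<lambda>j. l j + k j"])
      (auto simp: distrib_right sum.distrib)
qed

lemma affine_form_cmult: "affine_form n f \<Longrightarrow> affine_form n (\<lambda>r. d * f r)"
  \<comment> \<open>Only the parity of \<open>d\<close> matters: the product is the zero form or has
    the parity of \<open>f\<close>.\<close>
  using affine_form_const[of n 0] unfolding affine_form_def by (cases "even d") auto

lemma affine_form_sum: "(\<And>i. i \<in> A \<Longrightarrow> affine_form n (f i)) \<Longrightarrow> affine_form n (\<lambda>r. \<Sum>i\<in>A. f i r)"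
  by (induction A rule: infinite_finite_induct) (auto simp: affine_form_const affine_form_add)

lemma affine_form_cong:
  assumes "affine_form n f" "\<And>r. r < 2 ^ n \<Longrightarrow> even (f r) \<longleftrightarrow> even (g r)"
  shows "affine_form n g"
  using assms unfolding affine_form_def by (simp add: even_add)

text \<open>The derivative of an affine form in a fixed direction is constant, namely the linear
  part evaluated at \<open>s\<close>.\<close>

lemma affine_form_shift:
  assumes "affine_form n f"
  obtains d where "\<And>r c. shifted n s r c \<Longrightarrow> even (f r + f c + d)"
proof -
  obtain a l where f: "\<forall>r<2 ^ n. even (f r + a + (\<Sum>j<n. l j * qbit r j))"
    using assms unfolding affine_form_def by blast
  have "even (f r + f c + (\<Sum>j<n. l j * s j))" if "shifted n s r c" for r c
  proof -
    have "even (\<Sum>j<n. l j * (qbit r j + qbit c j + s j))"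
      using that unfolding shifted_def by (intro dvd_sum) simp
    then have "even ((\<Sum>j<n. l j * qbit r j) + (\<Sum>j<n. l j * qbit c j) + (\<Sum>j<n. l j * s j))"
      by (simp only: distrib_left sum.distrib)
    moreover have "r < 2 ^ n" "c < 2 ^ n"
      using that by (simp_all add: shifted_def)
    ultimately show ?thesis
      using f[rule_format, of r] f[rule_format, of c] by presburger
  qed
  then show ?thesis
    using that by blast
qed

lemma quadratic_formE:
  assumes "quadratic_form n q"
  obtains g where "affine_form n g" "\<And>r c. shifted n s r c \<Longrightarrow> even (q r + q c + g c)"
  using assms unfolding quadratic_form_def by blast

lemma quadratic_formI:
  assumes "\<And>s. \<exists>g. affine_form n g \<and> (\<forall>r c. shifted n s r c \<longrightarrow> even (q r + q c + g c))"
  shows "quadratic_form n q"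
  using assms unfolding quadratic_form_def by blast

lemma quadratic_form_add:
  assumes "quadratic_form n f" "quadratic_form n g"
  shows "quadratic_form n (\<lambda>r. f r + g r)"
proof (rule quadratic_formI)
  fix s
  obtain f' where f': "affine_form n f'" "\<And>r c. shifted n s r c \<Longrightarrow> even (f r + f c + f' c)"
    using quadratic_formE[OF assms(1)] by blast
  obtain g' where g': "affine_form n g'" "\<And>r c. shifted n s r c \<Longrightarrow> even (g r + g c + g' c)"
    using quadratic_formE[OF assms(2)] by blast
  have "even ((f r + g r) + (f c + g c) + (f' c + g' c))" if "shifted n s r c" for r c
    using f'(2)[OF that] g'(2)[OF that] by presburger
  then show "\<exists>h. affine_form n h \<and>
      (\<forall>r c. shifted n s r c \<longrightarrow> even ((f r + g r) + (f c + g c) + h c))"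
    using affine_form_add[OF f'(1) g'(1)] by blast
qed

text \<open>Product rule: modulo 2,
  \<open>(f + d) * (g + e) + f * g = d * g + e * f + d * e\<close>, where \<open>d\<close> and
  \<open>e\<close> are the constant derivatives of \<open>f\<close> and \<open>g\<close>.\<close>

lemma quadratic_form_mult_affine:
  assumes "affine_form n f" "affine_form n g"
  shows "quadratic_form n (\<lambda>r. f r * g r)"
proof (rule quadratic_formI)
  fix s
  obtain d where d: "\<And>r c. shifted n s r c \<Longrightarrow> even (f r + f c + d)"
    using affine_form_shift[OF assms(1)] by blast
  obtain e where e: "\<And>r c. shifted n s r c \<Longrightarrow> even (g r + g c + e)"
    using affine_form_shift[OF assms(2)] by blast
  have "affine_form n (\<lambda>c. d * g c + e * f c + d * e)"
    by (intro affine_form_add affine_form_cmult affine_form_const assms)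
  moreover have "even (f r * g r + f c * g c + (d * g c + e * f c + d * e))"
    if "shifted n s r c" for r c
    using d[OF that] e[OF that] unfolding even_add even_mult_iff by blast
  ultimately show "\<exists>h. affine_form n h \<and>
      (\<forall>r c. shifted n s r c \<longrightarrow> even (f r * g r + f c * g c + h c))"
    by blast
qed

lemma quadratic_form_affine: "affine_form n f \<Longrightarrow> quadratic_form n f"
  using quadratic_form_mult_affine[OF _ affine_form_const[of n 1]] by simp

lemma quadratic_form_cong:
  assumes "quadratic_form n f" "\<And>r. r < 2 ^ n \<Longrightarrow> even (f r) \<longleftrightarrow> even (g r)"
  shows "quadratic_form n g"
proof (rule quadratic_formI)
  fix s
  obtain f' where f': "affine_form n f'" "\<And>r c. shifted n s r c \<Longrightarrow> even (f r + f c + f' c)"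
    using quadratic_formE[OF assms(1)] by blast
  have "even (g r + g c + f' c)" if "shifted n s r c" for r c
  proof -
    have "r < 2 ^ n" "c < 2 ^ n"
      using that by (simp_all add: shifted_def)
    then show ?thesis
      using f'(2)[OF that] assms(2)[of r] assms(2)[of c] by presburger
  qed
  then show "\<exists>h. affine_form n h \<and> (\<forall>r c. shifted n s r c \<longrightarrow> even (g r + g c + h c))"
    using f'(1) by blast
qed

section \<open>Unitarity of the phase-Hadamard operator\<close>

text \<open>The unitary \<open>D H\<^sup>\<otimes>\<^sup>n\<close>, where \<open>D\<close> is diagonal with entries \<open>(-1) ^ q r\<close>.\<close>

definition phase_hadamard :: "nat \<Rightarrow> (nat \<Rightarrow> nat) \<Rightarrow> nat \<Rightarrow> nat \<Rightarrow> complex" where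
  "phase_hadamard n q r c = (if r < 2 ^ n \<and> c < 2 ^ n
     then of_real (1 / sqrt 2) ^ n * (- 1) ^ q r * (\<Prod>j<n. (- 1) ^ (qbit r j * qbit c j)) else 0)"

lemma inv_sqrt2_power: "of_real (1 / sqrt 2) ^ n * of_real (1 / sqrt 2) ^ n * (2::complex) ^ n = 1"
proof -
  have "(1 / sqrt 2) ^ n * (1 / sqrt 2) ^ n * (2::real) ^ n = 1"
    by (simp flip: power_mult_distrib)
  from arg_cong[OF this, of complex_of_real] show ?thesis
    by simp
qed

text \<open>Orthogonality of characters: a factor is 2 where the bits agree and 0 where they
  differ.\<close>

lemma prod_qbit_delta:
  assumes "r < 2 ^ n" "c < 2 ^ n"
  shows "(\<Prod>j<n. 1 + (- 1) ^ (qbit r j + qbit c j)) = (if r = c then 2 ^ n else (0::complex))"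
proof (cases "r = c")
  case True
  then show ?thesis by (simp add: minus_one_power_iff)
next
  case False
  then obtain j where j: "j < n" "qbit r j \<noteq> qbit c j"
    using qbit_ext[OF assms] by blast
  then have "(1::complex) + (- 1) ^ (qbit r j + qbit c j) = 0"
    using qbit_cases[of r j] qbit_cases[of c j] by auto
  then show ?thesis
    using False j(1) by (auto intro!: prod_zero)
qed

text \<open>Both products reduce to orthogonality of the Hadamard signs. With the adjoint on the
  right the phases leave the sum and cancel on the diagonal; with the adjoint on the left they
  square to 1 inside the sum.\<close>

lemma is_unitary_phase_hadamard: "is_unitary n (phase_hadamard n q)"
proof -
  let ?C = "phase_hadamard n q"
  let ?w = "of_real (1 / sqrt 2) ^ n :: complex"
  have orth: "(\<Sum>k<2 ^ n. \<Prod>j<n. (- 1) ^ (qbit r j * qbit k j) * (- 1) ^ (qbit c j * qbit k j))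
      = (if r = c then 2 ^ n else (0::complex))" if "r < 2 ^ n" "c < 2 ^ n" for r c
    using sum_prod_qbit[where n = n and g = "\<lambda>j a. (- 1) ^ (qbit r j * a) * (- 1) ^ (qbit c j * a) :: complex"]
      prod_qbit_delta[OF that] by (simp flip: power_add)
  have "mmult n ?C (madj ?C) r c = mid n r c" for r c
  proof (cases "r < 2 ^ n \<and> c < 2 ^ n")
    case True
    have "mmult n ?C (madj ?C) r c = ?w * ?w * (- 1) ^ q r * (- 1) ^ q c *
       (\<Sum>k<2 ^ n. \<Prod>j<n. (- 1) ^ (qbit r j * qbit k j) * (- 1) ^ (qbit c j * qbit k j))"
      using True by (simp add: mmult_def madj_def phase_hadamard_def sum_distrib_left prod.distrib
          mult_ac)
    also have "\<dots> = mid n r c"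
      unfolding orth[OF conjunct1[OF True] conjunct2[OF True]]
      using True inv_sqrt2_power[of n] by (simp add: mid_def minus_one_power_iff)
    finally show ?thesis .
  qed (auto simp: mmult_def mid_def)
  moreover have "mmult n (madj ?C) ?C r c = mid n r c" for r c
  proof (cases "r < 2 ^ n \<and> c < 2 ^ n")
    case True
    have sq: "(- 1) ^ q k * (- 1) ^ q k = (1::complex)" for k
      by (simp flip: power_add mult_2)
    have "madj ?C r k * ?C k c = ?w * ?w *
       (\<Prod>j<n. (- 1) ^ (qbit r j * qbit k j) * (- 1) ^ (qbit c j * qbit k j))" if "k < 2 ^ n" for k
    proof -
      have "madj ?C r k * ?C k c = ?w * ?w * ((- 1) ^ q k * (- 1) ^ q k) *
       (\<Prod>j<n. (- 1) ^ (qbit r j * qbit k j) * (- 1) ^ (qbit c j * qbit k j))"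
        using True that by (simp add: madj_def phase_hadamard_def prod.distrib mult_ac)
      then show ?thesis by (simp only: sq mult_1_right)
    qed
    then have "mmult n (madj ?C) ?C r c = ?w * ?w *
       (\<Sum>k<2 ^ n. \<Prod>j<n. (- 1) ^ (qbit r j * qbit k j) * (- 1) ^ (qbit c j * qbit k j))"
      using True by (simp add: mmult_def sum_distrib_left)
    also have "\<dots> = mid n r c"
      using True inv_sqrt2_power[of n] by (simp add: orth mid_def)
    finally show ?thesis .
  qed (auto simp: mmult_def mid_def)
  ultimately show ?thesis
    by (auto simp: is_unitary_def phase_hadamard_def fun_eq_iff)
qed

section \<open>Conjugation of Pauli operators and the Clifford property\<close>

text \<open>Conjugation by H fixes I, exchanges X and Z and negates Y. The factor 2 appears because
  the entries \<open>(-1) ^ (a * x)\<close> are not normalised.\<close>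

lemma hadamard_conj_pauli1:
  assumes "k < 4"
  shows "\<exists>e k'. k' < 4 \<and> (\<forall>a<2. \<forall>b<2.
     (\<Sum>x<2. \<Sum>y<2. (- 1) ^ (a * x) * pauli1 k x y * (- 1) ^ (b * y)) = 2 * \<i> ^ e * pauli1 k' a b)"
proof -
  have "k \<in> {0, 1, 2, 3}" using assms by auto
  then show ?thesis
    apply (elim insertE emptyE; simp only: numeral_2_eq_2 sum.lessThan_Suc less_Suc_eq)
    subgoal by (intro exI[of _ 0] exI[of _ 0]) (auto simp: pauli1_def)
    subgoal by (intro exI[of _ 0] exI[of _ 3]) (auto simp: pauli1_def)
    subgoal by (intro exI[of _ 2] exI[of _ 2]) (auto simp: pauli1_def)
    subgoal by (intro exI[of _ 0] exI[of _ 1]) (auto simp: pauli1_def)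
    done
qed

text \<open>The sign is right multiplication by \<open>Z^l\<close>. For odd \<open>l\<close> the
  witnesses are \<open>I Z = Z\<close>, \<open>X Z = -i Y\<close>, \<open>Y Z = i X\<close> and
  \<open>Z Z = I\<close>.\<close>

lemma pauli1_mult_sign:
  assumes "k < 4"
  shows "\<exists>e k'. k' < 4 \<and> (\<forall>a<2. \<forall>b<2. (- 1) ^ (l * b) * pauli1 k a b = \<i> ^ e * pauli1 k' a b)"
proof (cases "even l")
  case True
  then show ?thesis using assms by (intro exI[of _ 0] exI[of _ k]) auto
next
  case False
  have "k \<in> {0, 1, 2, 3}" using assms by auto
  then show ?thesis
    apply (elim insertE emptyE; simp only: numeral_2_eq_2 less_Suc_eq)
    subgoal using False by (intro exI[of _ 0] exI[of _ 3]) (auto simp: pauli1_def)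
    subgoal using False by (intro exI[of _ 3] exI[of _ 2]) (auto simp: pauli1_def power3_eq_cube)
    subgoal using False by (intro exI[of _ 1] exI[of _ 1]) (auto simp: pauli1_def)
    subgoal using False by (intro exI[of _ 0] exI[of _ 0]) (auto simp: pauli1_def)
    done
qed

lemma pauli1_support:
  "pauli1 k a b \<noteq> 0 \<Longrightarrow> a < 2 \<Longrightarrow> b < 2 \<Longrightarrow> even (a + b + (if k = 1 \<or> k = 2 then 1 else 0))"
  by (drule less_2_cases, drule less_2_cases, elim disjE) (simp_all add: pauli1_def split: if_splits)

text \<open>The diagonal part only contributes the sign \<open>(-1) ^ (q r + q c)\<close>. The
  remaining double sum factorises over the qubits into single-qubit Hadamard conjugations, whose
  factors 2 cancel the normalisation.\<close>

lemma conj_hadamard_pauli_op: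
  assumes "\<forall>j<n. ks j < 4"
  shows "\<exists>p ks'. (\<forall>j<n. ks' j < 4) \<and> (\<forall>r<2 ^ n. \<forall>c<2 ^ n.
    mmult n (mmult n (phase_hadamard n q) (pauli_op n ks)) (madj (phase_hadamard n q)) r c =
      (- 1) ^ (q r + q c) * \<i> ^ p * pauli_op n ks' r c)"
proof -
  let ?C = "phase_hadamard n q"
  let ?w = "of_real (1 / sqrt 2) ^ n :: complex"
  have "\<forall>j\<in>{..<n}. \<exists>e k'. k' < 4 \<and> (\<forall>a<2. \<forall>b<2. (\<Sum>x<2. \<Sum>y<2.
     (- 1) ^ (a * x) * pauli1 (ks j) x y * (- 1) ^ (b * y)) = 2 * \<i> ^ e * pauli1 k' a b)"
    using assms hadamard_conj_pauli1 by simp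
  from bchoice[OF this] obtain e where "\<forall>j\<in>{..<n}. \<exists>k'. k' < 4 \<and> (\<forall>a<2. \<forall>b<2. (\<Sum>x<2. \<Sum>y<2.
     (- 1) ^ (a * x) * pauli1 (ks j) x y * (- 1) ^ (b * y)) = 2 * \<i> ^ e j * pauli1 k' a b)" ..
  from bchoice[OF this] obtain ks' where ks': "\<And>j. j < n \<Longrightarrow> ks' j < 4"
    and e: "\<And>j a b. j < n \<Longrightarrow> a < 2 \<Longrightarrow> b < 2 \<Longrightarrow> (\<Sum>x<2. \<Sum>y<2.
     (- 1) ^ (a * x) * pauli1 (ks j) x y * (- 1) ^ (b * y)) = 2 * \<i> ^ e j * pauli1 (ks' j) a b"
    by (auto simp only: lessThan_iff)
  have "mmult n (mmult n ?C (pauli_op n ks)) (madj ?C) r c =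
      (- 1) ^ (q r + q c) * \<i> ^ (\<Sum>j<n. e j) * pauli_op n ks' r c"
    if r: "r < 2 ^ n" and c: "c < 2 ^ n" for r c
  proof -
    let ?g = "\<lambda>j a b. (- 1) ^ (qbit r j * a) * pauli1 (ks j) a b * (- 1) ^ (qbit c j * b)"
    have "mmult n (mmult n ?C (pauli_op n ks)) (madj ?C) r c =
        (\<Sum>l<2 ^ n. \<Sum>k<2 ^ n. ?C r k * pauli_op n ks k l * madj ?C l c)"
      using r c by (simp add: mmult_def sum_distrib_right)
    also have "\<dots> = (\<Sum>k<2 ^ n. \<Sum>l<2 ^ n. ?C r k * pauli_op n ks k l * madj ?C l c)"
      by (rule sum.swap)
    also have "\<dots> = (\<Sum>k<2 ^ n. \<Sum>l<2 ^ n. ?w * ?w * (- 1) ^ (q r + q c) *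
        (\<Prod>j<n. ?g j (qbit k j) (qbit l j)))"
      using r c by (intro sum.cong refl)
        (simp add: phase_hadamard_def pauli_op_def madj_def prod.distrib power_add mult_ac)
    also have "\<dots> = ?w * ?w * (- 1) ^ (q r + q c) * (\<Sum>k<2 ^ n. \<Sum>l<2 ^ n.
        (\<Prod>j<n. ?g j (qbit k j) (qbit l j)))"
      by (simp add: sum_distrib_left)
    also have "\<dots> = ?w * ?w * (- 1) ^ (q r + q c) *
        (\<Prod>j<n. ?g j 0 0 + ?g j 0 1 + ?g j 1 0 + ?g j 1 1)"
      by (simp only: sum_sum_prod_qbit[where g = ?g])
    also have "\<dots> = ?w * ?w * (- 1) ^ (q r + q c) *
        (\<Prod>j<n. 2 * \<i> ^ e j * pauli1 (ks' j) (qbit r j) (qbit c j))"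
    proof -
      have "?g j 0 0 + ?g j 0 1 + ?g j 1 0 + ?g j 1 1
          = 2 * \<i> ^ e j * pauli1 (ks' j) (qbit r j) (qbit c j)" if "j < n" for j
        unfolding e[OF that qbit_less_2 qbit_less_2, symmetric]
        by (simp add: numeral_2_eq_2 add_ac)
      then show ?thesis
        by (intro arg_cong2[where f = times] refl prod.cong) simp_all
    qed
    also have "\<dots> = (?w * ?w * 2 ^ n) * ((- 1) ^ (q r + q c) * \<i> ^ (\<Sum>j<n. e j) * pauli_op n ks' r c)"
      using r c by (simp add: prod.distrib power_sum pauli_op_def mult_ac)
    finally show ?thesis
      by (simp only: inv_sqrt2_power mult_1_left)
  qed
  then show ?thesis
    using ks' by blast
qed

text \<open>The sign of an affine form is a global sign times a product of single-qubit signs, and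
  each of these is absorbed into its Pauli factor.\<close>

lemma affine_phase_pauli_op:
  assumes "affine_form n g" "\<forall>j<n. ks j < 4"
  shows "\<exists>p ks'. (\<forall>j<n. ks' j < 4) \<and>
    (\<forall>r c. c < 2 ^ n \<longrightarrow> (- 1) ^ g c * pauli_op n ks r c = \<i> ^ p * pauli_op n ks' r c)"
proof -
  obtain a l where al: "\<forall>r<2 ^ n. even (g r + a + (\<Sum>j<n. l j * qbit r j))"
    using assms(1) unfolding affine_form_def by blast
  have "\<forall>j\<in>{..<n}. \<exists>e k'. k' < 4 \<and> (\<forall>a<2. \<forall>b<2.
      (- 1) ^ (l j * b) * pauli1 (ks j) a b = \<i> ^ e * pauli1 k' a b)"
    using assms(2) pauli1_mult_sign by simp
  from bchoice[OF this] obtain e where "\<forall>j\<in>{..<n}. \<exists>k'. k' < 4 \<and> (\<forall>a<2. \<forall>b<2.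
      (- 1) ^ (l j * b) * pauli1 (ks j) a b = \<i> ^ e j * pauli1 k' a b)" ..
  from bchoice[OF this] obtain ks' where ks': "\<And>j. j < n \<Longrightarrow> ks' j < 4"
    and e: "\<And>j a b. j < n \<Longrightarrow> a < 2 \<Longrightarrow> b < 2 \<Longrightarrow>
      (- 1) ^ (l j * b) * pauli1 (ks j) a b = \<i> ^ e j * pauli1 (ks' j) a b"
    by (auto simp only: lessThan_iff)
  \<comment> \<open>The global sign \<open>(-1) ^ a\<close> is written as
    \<open>\<i> ^ (2 * a)\<close>.\<close>
  have "(- 1) ^ g c * pauli_op n ks r c = \<i> ^ (2 * a + (\<Sum>j<n. e j)) * pauli_op n ks' r c"
    if c: "c < 2 ^ n" for r c
  proof (cases "r < 2 ^ n")
    case True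
    have "(- 1) ^ g c = ((- 1) ^ (a + (\<Sum>j<n. l j * qbit c j)) :: complex)"
      using al c by (auto simp: minus_one_power_iff even_add)
    also have "\<dots> = (- 1) ^ a * (\<Prod>j<n. (- 1) ^ (l j * qbit c j))"
      by (simp add: power_add power_sum)
    finally have "(- 1) ^ g c * pauli_op n ks r c
        = (- 1) ^ a * (\<Prod>j<n. (- 1) ^ (l j * qbit c j) * pauli1 (ks j) (qbit r j) (qbit c j))"
      using True c by (simp add: pauli_op_def prod.distrib)
    also have "\<dots> = (- 1) ^ a * (\<Prod>j<n. \<i> ^ e j * pauli1 (ks' j) (qbit r j) (qbit c j))"
      by (simp add: e qbit_less_2)
    also have "\<dots> = \<i> ^ (2 * a + (\<Sum>j<n. e j)) * pauli_op n ks' r c"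
      using True c by (simp add: pauli_op_def prod.distrib power_sum power_add power_mult)
    finally show ?thesis .
  qed (simp add: pauli_op_def)
  then show ?thesis
    using ks' by blast
qed

text \<open>After the Hadamard conjugation a Pauli operator is left with entries multiplied by
  \<open>(-1) ^ (q r + q c)\<close>. Its nonzero entries have \<open>r = c + s\<close>, where this
  exponent is affine in \<open>c\<close> modulo 2, so the sign is absorbed into another Pauli
  operator.\<close>

lemma is_clifford_phase_hadamard:
  assumes "quadratic_form n q"
  shows "is_clifford n (phase_hadamard n q)"
  unfolding is_clifford_def
proof (intro conjI ballI)
  let ?C = "phase_hadamard n q"
  fix P assume "P \<in> pauli_group n"
  then obtain p ks where ks: "\<forall>j<n. ks j < 4" and P: "P = (\<lambda>r c. \<i> ^ p * pauli_op n ks r c)"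
    unfolding pauli_group_def by blast
  obtain p1 ks1 where ks1: "\<forall>j<n. ks1 j < 4" and C1: "\<forall>r<2 ^ n. \<forall>c<2 ^ n.
      mmult n (mmult n ?C (pauli_op n ks)) (madj ?C) r c =
      (- 1) ^ (q r + q c) * \<i> ^ p1 * pauli_op n ks1 r c"
    using conj_hadamard_pauli_op[OF ks, of q] by blast
  \<comment> \<open>The shift marks the qubits carrying X or Y, the two Pauli matrices that flip a
    bit.\<close>
  define s where "s j = (if ks1 j = 1 \<or> ks1 j = 2 then 1 else 0 :: nat)" for j
  obtain g where g: "affine_form n g"
    and qg: "\<And>r c. shifted n s r c \<Longrightarrow> even (q r + q c + g c)"
    using quadratic_formE[OF assms] by blast
  obtain p2 ks2 where ks2: "\<forall>j<n. ks2 j < 4" and C2: "\<forall>r c. c < 2 ^ n \<longrightarrow>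
      (- 1) ^ g c * pauli_op n ks1 r c = \<i> ^ p2 * pauli_op n ks2 r c"
    using affine_phase_pauli_op[OF g ks1] by blast
  have "mmult n (mmult n ?C P) (madj ?C) r c = \<i> ^ (p + p1 + p2) * pauli_op n ks2 r c" for r c
  proof (cases "r < 2 ^ n \<and> c < 2 ^ n")
    case True
    have phase: "(- 1) ^ (q r + q c) * pauli_op n ks1 r c = (- 1) ^ g c * pauli_op n ks1 r c"
    proof (cases "pauli_op n ks1 r c = 0")
      case False
      then have "\<forall>j<n. pauli1 (ks1 j) (qbit r j) (qbit c j) \<noteq> 0"
        using True by (auto simp: pauli_op_def)
      then have "\<forall>j<n. even (qbit r j + qbit c j + s j)"
        unfolding s_def using pauli1_support qbit_less_2 by blast
      then have "even (q r + q c + g c)"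
        using qg True by (simp add: shifted_def)
      then show ?thesis
        by (auto simp: minus_one_power_iff even_add)
    qed simp
    have "mmult n (mmult n ?C P) (madj ?C) r c
        = \<i> ^ p * mmult n (mmult n ?C (pauli_op n ks)) (madj ?C) r c"
      using True by (simp add: P mmult_def sum_distrib_left sum_distrib_right mult_ac)
    also have "\<dots> = \<i> ^ p * \<i> ^ p1 * ((- 1) ^ (q r + q c) * pauli_op n ks1 r c)"
      using C1 True by (simp add: mult_ac)
    also have "\<dots> = \<i> ^ (p + p1 + p2) * pauli_op n ks2 r c"
      unfolding phase using C2 True by (simp add: power_add)
    finally show ?thesis .
  qed (auto simp: mmult_def pauli_op_def)
  then show "mmult n (mmult n ?C P) (madj ?C) \<in> pauli_group n"
    using ks2 unfolding pauli_group_def by blast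
qed (rule is_unitary_phase_hadamard)

lemma stabilizer_state_quadratic:
  assumes "quadratic_form n q"
  shows "stabilizer_state n (\<lambda>r. if r < 2 ^ n then of_real (1 / sqrt 2) ^ n * (- 1) ^ q r else 0)"
  unfolding stabilizer_state_def
proof (intro exI conjI)
  show "is_clifford n (phase_hadamard n q)"
    by (rule is_clifford_phase_hadamard[OF assms])
\<comment> \<open>In column 0 all bits of the column label vanish, so the Hadamard signs are
  1.\<close>
qed (auto simp: phase_hadamard_def fun_eq_iff qbit_def)

section \<open>Combinations of quadratic phases\<close>

definition quad_decomp :: "nat \<Rightarrow> (nat \<Rightarrow> complex) \<Rightarrow> nat \<Rightarrow> bool" where
  "quad_decomp n v k \<longleftrightarrow> (\<exists>(c :: nat \<Rightarrow> complex) q. (\<forall>i<k. quadratic_form n (q i)) \<and>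
     (\<forall>r<2 ^ n. v r = (\<Sum>i<k. c i * (- 1) ^ q i r)))"

lemma quad_decomp_const: "quad_decomp n (\<lambda>_. a) 1"
  unfolding quad_decomp_def
  by (intro exI[of _ "\<lambda>_. a"] exI[of _ "\<lambda>_ _. 0"])
    (simp add: quadratic_form_affine affine_form_const)

text \<open>Each term \<open>(-1) ^ q i r\<close> splits into itself and
  \<open>(-1) ^ (q i r + p r)\<close>, which doubles the count; the new terms take the indices from
  \<open>k\<close> on.\<close>

lemma quad_decomp_mult:
  assumes v: "quad_decomp n v k" and p: "quadratic_form n p"
    and v': "\<And>r. r < 2 ^ n \<Longrightarrow> v' r = v r * (a + b * (- 1) ^ p r)"
  shows "quad_decomp n v' (2 * k)"
proof -
  obtain c q where q: "\<forall>i<k. quadratic_form n (q i)"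
    and c: "\<forall>r<2 ^ n. v r = (\<Sum>i<k. c i * (- 1) ^ q i r)"
    using v unfolding quad_decomp_def by blast
  define c' where "c' i = (if i < k then c i * a else c (i - k) * b)" for i
  define q' where "q' i = (if i < k then q i else (\<lambda>r. q (i - k) r + p r))" for i
  have "\<forall>i<2 * k. quadratic_form n (q' i)"
    using q p by (auto simp: q'_def intro!: quadratic_form_add)
  moreover have "v' r = (\<Sum>i<2 * k. c' i * (- 1) ^ q' i r)" if "r < 2 ^ n" for r
  proof -
    have "(\<Sum>i<2 * k. c' i * (- 1) ^ q' i r)
        = (\<Sum>i<k. c' i * (- 1) ^ q' i r) + (\<Sum>i<k. c' (k + i) * (- 1) ^ q' (k + i) r)"
      by (simp only: mult_2 sum_lessThan_add)
    also have "\<dots> = v r * (a + b * (- 1) ^ p r)"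
      using c that by (simp add: c'_def q'_def sum_distrib_left sum_distrib_right power_add
          sum.distrib distrib_left mult_ac)
    finally show ?thesis
      using v' that by simp
  qed
  ultimately show ?thesis
    unfolding quad_decomp_def by blast
qed

lemma stab_decomp_if_quad_decomp:
  assumes "quad_decomp n v k" "\<And>r. \<not> r < 2 ^ n \<Longrightarrow> v r = 0"
  shows "stab_decomp n v k"
proof -
  obtain c q where q: "\<forall>i<k. quadratic_form n (q i)"
    and c: "\<forall>r<2 ^ n. v r = (\<Sum>i<k. c i * (- 1) ^ q i r)"
    using assms(1) unfolding quad_decomp_def by blast
  \<comment> \<open>The normalisation of the stabilizer states, compensated by dividing the
    coefficients by it.\<close>
  define w :: complex where "w = of_real (1 / sqrt 2) ^ n"
  have "w \<noteq> 0"
    by (simp add: w_def)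
  then have "v r = (\<Sum>i<k. c i / w * (if r < 2 ^ n then w * (- 1) ^ q i r else 0))" for r
    using c assms(2)[of r] by (cases "r < 2 ^ n") simp_all
  then have "v = (\<lambda>r. \<Sum>i<k. c i / w * (if r < 2 ^ n then w * (- 1) ^ q i r else 0))" ..
  then show ?thesis
    unfolding stab_decomp_def
    using q stabilizer_state_quadratic[where n = n, folded w_def]
    by (intro exI[of _ "\<lambda>i. c i / w"]
        exI[of _ "\<lambda>i r. if r < 2 ^ n then w * (- 1) ^ q i r else 0"]) simp
qed

section \<open>Full-adder carries and powers of bit sums\<close>

text \<open>Adding the bits \<open>u i\<close> two at a time to the current parity, the carry of each full adder is a
  majority of three affine forms, hence quadratic.\<close>

lemma quadratic_form_carry:
  fixes u :: "nat \<Rightarrow> nat \<Rightarrow> nat"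
  assumes u: "\<And>i. affine_form n (\<lambda>r. u r i)" "\<And>r i. u r i \<le> 1"
  defines "S \<equiv> \<lambda>r k. \<Sum>i<k. u r i"
  shows "quadratic_form n (\<lambda>r. S r (Suc (Suc k)) div 2 - S r k div 2)"
    and "S r (Suc (Suc k)) div 2 \<in> {S r k div 2, Suc (S r k div 2)}"
proof -
  have "affine_form n (\<lambda>r. S r k)"
    unfolding S_def by (intro affine_form_sum u)
  \<comment> \<open>With bits \<open>u\<close>, \<open>v\<close> and running sum \<open>S\<close>,
    the polynomial \<open>u * v + (u + v) * S\<close> has the parity of the carry; \<open>S\<close>
    may replace its own parity here.\<close>
  then have "quadratic_form n (\<lambda>r. u r k * u r (Suc k) + (u r k + u r (Suc k)) * S r k)"
    by (intro quadratic_form_add quadratic_form_mult_affine affine_form_add u)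
  moreover have "even (u r k * u r (Suc k) + (u r k + u r (Suc k)) * S r k) \<longleftrightarrow>
      even (S r (Suc (Suc k)) div 2 - S r k div 2)" for r
  proof -
    have "S r (Suc (Suc k)) = S r k + u r k + u r (Suc k)"
      by (simp add: S_def)
    moreover have "u r k = 0 \<or> u r k = 1" "u r (Suc k) = 0 \<or> u r (Suc k) = 1"
      using u(2)[of r k] u(2)[of r "Suc k"] by linarith+
    ultimately show ?thesis
      by (cases "even (S r k)") (elim evenE oddE disjE; simp)+
  qed
  ultimately show "quadratic_form n (\<lambda>r. S r (Suc (Suc k)) div 2 - S r k div 2)"
    by (rule quadratic_form_cong)
  have "S r (Suc (Suc k)) = S r k + u r k + u r (Suc k)"
    by (simp add: S_def)
  then show "S r (Suc (Suc k)) div 2 \<in> {S r k div 2, Suc (S r k div 2)}"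
    using u(2)[of r k] u(2)[of r "Suc k"] by auto
qed

text \<open>Each of the \<open>k\<close> carries doubles the number of terms, and the final parity
  bit doubles it once more.\<close>

lemma quad_decomp_power_sum:
  fixes u :: "nat \<Rightarrow> nat \<Rightarrow> nat" and z :: complex
  assumes u: "\<And>i. affine_form n (\<lambda>r. u r i)" "\<And>r i. u r i \<le> 1"
  shows "quad_decomp n (\<lambda>r. z ^ (\<Sum>i<2 * k. u r i)) (2 ^ Suc k)"
proof -
  define S where "S r k = (\<Sum>i<k. u r i)" for r k
  have half: "quad_decomp n (\<lambda>r. (z ^ 2) ^ (S r (2 * k) div 2)) (2 ^ k)"
  proof (induction k)
    case 0
    then show ?case
      using quad_decomp_const[of n 1] by (simp add: S_def)
  next
    case (Suc k)
    let ?t = "\<lambda>r. S r (2 * Suc k) div 2 - S r (2 * k) div 2"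
    have "quadratic_form n ?t"
      using quadratic_form_carry(1)[where u = u, OF u, of "2 * k"] by (simp add: S_def)
    \<comment> \<open>Interpolation on the carry \<open>t\<close>, which is 0 or 1:
      \<open>(1 + w) / 2 + (1 - w) / 2 * (-1) ^ t = w ^ t\<close> with
      \<open>w = z ^ 2\<close>.\<close>
    moreover have "(z ^ 2) ^ (S r (2 * Suc k) div 2) =
        (z ^ 2) ^ (S r (2 * k) div 2) * ((1 + z ^ 2) / 2 + (1 - z ^ 2) / 2 * (- 1) ^ ?t r)" for r
    proof -
      have "S r (2 * Suc k) div 2 \<in> {S r (2 * k) div 2, Suc (S r (2 * k) div 2)}"
        using quadratic_form_carry(2)[where u = u, OF u, of r "2 * k"] by (simp add: S_def)
      then show ?thesis
      proof (elim insertE emptyE)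
        assume *: "S r (2 * Suc k) div 2 = S r (2 * k) div 2"
        show ?thesis unfolding * by (simp add: field_simps)
      next
        assume *: "S r (2 * Suc k) div 2 = Suc (S r (2 * k) div 2)"
        show ?thesis unfolding * by (simp add: field_simps)
      qed
    qed
    ultimately show ?case
      unfolding power_Suc[of 2 k] by (rule quad_decomp_mult[OF Suc])
  qed
  have "quadratic_form n (\<lambda>r. S r (2 * k))"
    unfolding S_def by (intro quadratic_form_affine affine_form_sum u)
  \<comment> \<open>The same interpolation with \<open>w = z\<close> supplies the factor
    \<open>z\<close> exactly when the sum is odd.\<close>
  moreover have "z ^ S r (2 * k) =
      (z ^ 2) ^ (S r (2 * k) div 2) * ((1 + z) / 2 + (1 - z) / 2 * (- 1) ^ S r (2 * k))" for r
  proof (cases "even (S r (2 * k))")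
    case True
    then show ?thesis by (simp flip: power_mult add: field_simps)
  next
    case False
    then have "z ^ S r (2 * k) = z ^ (2 * (S r (2 * k) div 2) + 1)"
      by simp
    also have "\<dots> = (z ^ 2) ^ (S r (2 * k) div 2) * z"
      by (simp only: power_add power_mult power_one_right)
    finally show ?thesis using False by (simp add: field_simps)
  qed
  ultimately have "quad_decomp n (\<lambda>r. z ^ S r (2 * k)) (2 * 2 ^ k)"
    by (rule quad_decomp_mult[OF half])
  then show ?thesis
    by (simp only: S_def power_Suc)
qed

section \<open>Tensor powers and the asymptotic bound\<close>

lemma quad_decomp_cmult:
  assumes "quad_decomp n v k"
  shows "quad_decomp n (\<lambda>r. a * v r) k"
proof -
  obtain c q where "\<forall>i<k. quadratic_form n (q i)"
    and "\<forall>r<2 ^ n. v r = (\<Sum>i<k. c i * (- 1) ^ q i r)"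
    using assms unfolding quad_decomp_def by blast
  then show ?thesis
    unfolding quad_decomp_def
    by (intro exI[of _ "\<lambda>i. a * c i"] exI[of _ q]) (simp add: sum_distrib_left mult.assoc)
qed

lemma quad_decomp_cong:
  "quad_decomp n v k \<Longrightarrow> (\<And>r. r < 2 ^ n \<Longrightarrow> v r = w r) \<Longrightarrow> quad_decomp n w k"
  unfolding quad_decomp_def by simp

lemma stab_decomp_tpow:
  assumes "\<psi> 0 \<noteq> 0 \<or> \<psi> 1 \<noteq> 0"
  shows "stab_decomp m (tpow m \<psi>) (2 ^ Suc ((m + 1) div 2))"
proof -
  \<comment> \<open>The nonzero amplitude serves as the reference, so that the ratio
    \<open>z\<close> is meaningful; \<open>z\<close> itself may be 0.\<close>
  obtain e :: nat where e: "e = 0 \<or> e = 1" "\<psi> e \<noteq> 0"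
    using assms by blast
  define z where "z = \<psi> (1 - e) / \<psi> e"
  \<comment> \<open>The bit records whether qubit \<open>i\<close> differs from \<open>e\<close>.
    Padding with 0 from \<open>m\<close> on lets the bits be grouped in pairs also when
    \<open>m\<close> is odd.\<close>
  define u where "u r i = (if i < m then (qbit r i + e) mod 2 else 0)" for r i
  have u1: "u r i \<le> 1" for r i
    by (simp add: u_def mod2_eq_if)
  have ua: "affine_form m (\<lambda>r. u r i)" for i
  proof (cases "i < m")
    case True
    show ?thesis
      by (rule affine_form_cong[OF affine_form_add[OF affine_form_qbit[of m i] affine_form_const[of m e]]])
        (simp add: u_def True even_mod_2_iff)
  qed (simp add: u_def affine_form_const)
  have \<psi>: "\<psi> (qbit r i) = \<psi> e * z ^ u r i" if "i < m" for r i
    using e qbit_cases[of r i] that by (elim disjE) (simp_all add: u_def z_def)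
  let ?k = "(m + 1) div 2"
  have "\<psi> e ^ m * z ^ (\<Sum>i<2 * ?k. u r i) = tpow m \<psi> r" if "r < 2 ^ m" for r
  proof -
    have "(\<Sum>i<2 * ?k. u r i) = (\<Sum>i<m. u r i)"
      by (intro sum.mono_neutral_right) (auto simp: u_def)
    then show ?thesis
      using that by (simp add: tpow_def \<psi> prod.distrib power_sum)
  qed
  with quad_decomp_cmult[OF quad_decomp_power_sum[where u = u, OF ua u1, of z ?k], of "\<psi> e ^ m"]
  have "quad_decomp m (tpow m \<psi>) (2 ^ Suc ?k)"
    by (rule quad_decomp_cong)
  then show ?thesis
    by (rule stab_decomp_if_quad_decomp) (simp add: tpow_def)
qed

theorem theorem3:
  fixes \<psi> :: "nat \<Rightarrow> complex"
  assumes "\<forall>r\<ge>2. \<psi> r = 0"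
    and "(cmod (\<psi> 0))\<^sup>2 + (cmod (\<psi> 1))\<^sup>2 = 1"
  shows "(\<lambda>m. real (stab_rank m (tpow m \<psi>))) \<in> O(\<lambda>m. (real m + 1) * 2 powr (real m / 2))"
proof (rule bigoI[where c = 4], rule always_eventually, rule allI)
  fix m
  have "\<psi> 0 \<noteq> 0 \<or> \<psi> 1 \<noteq> 0"
    using assms(2) by auto
  then have "stab_rank m (tpow m \<psi>) \<le> 2 ^ Suc ((m + 1) div 2)"
    unfolding stab_rank_def by (intro Least_le stab_decomp_tpow)
  then have "real (stab_rank m (tpow m \<psi>)) \<le> real (2 ^ Suc ((m + 1) div 2))"
    by (simp only: of_nat_le_iff)
  also have "\<dots> = 2 powr real (Suc ((m + 1) div 2))"
    by (simp only: of_nat_power of_nat_numeral powr_realpow[OF zero_less_numeral])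
  \<comment> \<open>The worst case is odd \<open>m\<close>, where the exponent is
    \<open>m / 2 + 3 / 2\<close>; rounding up to \<open>2 + m / 2\<close> yields the constant
    4.\<close>
  also have "\<dots> \<le> 2 powr (2 + real m / 2)"
    by (intro powr_mono) linarith+
  also have "\<dots> = 4 * (1 * 2 powr (real m / 2))"
    by (simp add: powr_add)
  also have "\<dots> \<le> 4 * ((real m + 1) * 2 powr (real m / 2))"
    by (intro mult_left_mono mult_right_mono) auto
  finally show "norm (real (stab_rank m (tpow m \<psi>))) \<le>
      4 * norm ((real m + 1) * 2 powr (real m / 2))"
    by simp
qed

end
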